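(* There is a polynomial-time reduction that maps every instance $\mathcal{I}=(G,R,I,\iota,(A_h)_{h\in I})$ of the Anonymous Refugees Housing problem to an equivalent instance $\mathcal{J}=(G,R,(A'_r)_{r\in R},I,\iota,(A'_h)_{h\in I})$ of the Hedonic Refugees Housing problem with the same topology $G$, the same sets $R$ and $I$, and the same inhabitants assignment $\iota$. Here equivalent means that $\mathcal{I}$ is a yes-instance if and only if $\mathcal{J}$ is a yes-instance.
   Context: Common setting: $G=(V,E)$ is a finite simple undirected graph (the topology); $R$ is a finite non-empty set of refugees and $I$ a finite set of inhabitants with $|V|\ge |R|+|I|$; $\iota\colon I\to V$ is injective; $V_I=\iota(I)$, $V_U=V\setminus V_I$. A housing is an injective map $\pi\colon R\to V_U$. Anonymous Refugees Housing: each $h\in I$ has a non-empty approval set $A_h\subseteq\{0,1,\ldots,\deg(\iota(h))\}$; the instance is a yes-instance iff there is a housing $\pi$ with $|N_G(\iota(h))\cap \pi(R)|\in A_h$ for all $h\in I$. Hedonic Refugees Housing: each $h\in I$ has an approval set $A'_h\subseteq 2^R$ and each $r\in R$ has an approval set $A'_r\subseteq 2^I$; the instance is a yes-instance iff there is a housing $\pi$ that is respecting, i.e. $\{r\in R: \pi(r)\in N_G(\iota(h))\}\in A'_h$ for every $h\in I$ and $\{h\in I:\iota(h)\in N_G(\pi(r))\}\in A'_r$ for every $r\in R$. Since hedonic approval sets may have exponential size, they are not listed explicitly: the approval set of each agent is given as an oracle that, for a given subset of agents of the opposite group, returns true iff this subset is approved. A reduction producing a hedonic instance outputs polynomial-time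 procedures (of polynomial description size) that implement these oracles. *)

theory Defs
  imports Main
    "HOL-Computational_Algebra.Polynomial"
    "HOL-Combinatorics.Multiset_Permutations"
begin

section \<open>Refugees Housing\<close>

record 'v ugraph =
  verts :: "'v set"
  edges :: "'v set set"

definition simple_graph :: "'v ugraph \<Rightarrow> bool" where
  "simple_graph G \<longleftrightarrow> finite (verts G) \<and>
     (\<forall>e\<in>edges G. \<exists>u\<in>verts G. \<exists>v\<in>verts G. u \<noteq> v \<and> e = {u, v})"

definition neighbours :: "'v ugraph \<Rightarrow> 'v \<Rightarrow> 'v set" where
  "neighbours G v = {u. {u, v} \<in> edges G}"

definition degree :: "'v ugraph \<Rightarrow> 'v \<Rightarrow> nat" where
  "degree G v = card (neighbours G v)"

text \<open>The data shared by both problems. Maps such as \<open>iota\<close> are total functions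
  of which only the values on the stated domain (here, the inhabitants) are meaningful.\<close>

record ('v, 'r, 'i) setting =
  topology :: "'v ugraph"
  refugees :: "'r set"
  inhabitants :: "'i set"
  iota :: "'i \<Rightarrow> 'v"

definition valid_setting :: "('v, 'r, 'i, 'z) setting_scheme \<Rightarrow> bool" where
  "valid_setting X \<longleftrightarrow>
     simple_graph (topology X) \<and>
     finite (refugees X) \<and> refugees X \<noteq> {} \<and> finite (inhabitants X) \<and>
     card (refugees X) + card (inhabitants X) \<le> card (verts (topology X)) \<and>
     inj_on (iota X) (inhabitants X) \<and> iota X ` inhabitants X \<subseteq> verts (topology X)"

definition housing :: "('v, 'r, 'i, 'z) setting_scheme \<Rightarrow> ('r \<Rightarrow> 'v) \<Rightarrow> bool" where
  "housing X \<pi> \<longleftrightarrow>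
     inj_on \<pi> (refugees X) \<and>
     \<pi> ` refugees X \<subseteq> verts (topology X) - iota X ` inhabitants X"

record ('v, 'r, 'i) anonymous = "('v, 'r, 'i) setting" +
  approved_numbers :: "'i \<Rightarrow> nat set"

definition anonymous_instance :: "('v, 'r, 'i) anonymous \<Rightarrow> bool" where
  "anonymous_instance X \<longleftrightarrow> valid_setting X \<and>
     (\<forall>h\<in>inhabitants X. approved_numbers X h \<noteq> {} \<and>
        approved_numbers X h \<subseteq> {0..degree (topology X) (iota X h)})"

definition anonymous_yes :: "('v, 'r, 'i) anonymous \<Rightarrow> bool" where
  "anonymous_yes X \<longleftrightarrow> (\<exists>\<pi>. housing X \<pi> \<and>
     (\<forall>h\<in>inhabitants X.
        card (neighbours (topology X) (iota X h) \<inter> \<pi> ` refugees X) \<in> approved_numbers X h))"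

record ('v, 'r, 'i) hedonic = "('v, 'r, 'i) setting" +
  refugee_approval :: "'r \<Rightarrow> 'i set set"
  inhabitant_approval :: "'i \<Rightarrow> 'r set set"

definition hedonic_instance :: "('v, 'r, 'i) hedonic \<Rightarrow> bool" where
  "hedonic_instance X \<longleftrightarrow> valid_setting X \<and>
     (\<forall>r\<in>refugees X. refugee_approval X r \<subseteq> Pow (inhabitants X)) \<and>
     (\<forall>h\<in>inhabitants X. inhabitant_approval X h \<subseteq> Pow (refugees X))"

definition respecting :: "('v, 'r, 'i) hedonic \<Rightarrow> ('r \<Rightarrow> 'v) \<Rightarrow> bool" where
  "respecting X \<pi> \<longleftrightarrow>
     (\<forall>h\<in>inhabitants X.
        {r \<in> refugees X. \<pi> r \<in> neighbours (topology X) (iota X h)} \<in> inhabitant_approval X h) \<and>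
     (\<forall>r\<in>refugees X.
        {h \<in> inhabitants X. iota X h \<in> neighbours (topology X) (\<pi> r)} \<in> refugee_approval X r)"

definition hedonic_yes :: "('v, 'r, 'i) hedonic \<Rightarrow> bool" where
  "hedonic_yes X \<longleftrightarrow> (\<exists>\<pi>. housing X \<pi> \<and> respecting X \<pi>)"


section \<open>Model of computation\<close>

text \<open>
  Polynomial time is measured for the WHILE language over binary trees of N. D. Jones
  (Computability and Complexity from a Programming Perspective, 1997). Instead of unit cost
  per operation, every evaluated subexpression is charged the size of its value. No data can
  therefore be produced without paying for its size as a tree, and running times agree with
  those of (multitape) Turing machines up to a polynomial.
\<close>

datatype data = Atom | Pair data data

text \<open>The automatically generated \<open>size\<close> would be 0 on \<open>Atom\<close>; count all tree nodes instead.\<close>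

primrec dsize :: "data \<Rightarrow> nat" where
  "dsize Atom = 1"
| "dsize (Pair a b) = 1 + dsize a + dsize b"

datatype expr = Var nat | Const data | MkPair expr expr | Fst expr | Snd expr | Equal expr expr

datatype com = Skip | Assign nat expr | Seq com com | Cond expr com com | While expr com

type_synonym store = "nat \<Rightarrow> data"

primrec data_fst :: "data \<Rightarrow> data" where
  "data_fst Atom = Atom"
| "data_fst (Pair a b) = a"

primrec data_snd :: "data \<Rightarrow> data" where
  "data_snd Atom = Atom"
| "data_snd (Pair a b) = b"

definition enc_bool :: "bool \<Rightarrow> data" where
  "enc_bool b = (if b then Pair Atom Atom else Atom)"

primrec val :: "expr \<Rightarrow> store \<Rightarrow> data" where
  "val (Var x) s = s x"
| "val (Const d) s = d"
| "val (MkPair a b) s = Pair (val a s) (val b s)"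
| "val (Fst a) s = data_fst (val a s)"
| "val (Snd a) s = data_snd (val a s)"
| "val (Equal a b) s = enc_bool (val a s = val b s)"

primrec cost :: "expr \<Rightarrow> store \<Rightarrow> nat" where
  "cost (Var x) s = dsize (val (Var x) s)"
| "cost (Const d) s = dsize (val (Const d) s)"
| "cost (MkPair a b) s = cost a s + cost b s + dsize (val (MkPair a b) s)"
| "cost (Fst a) s = cost a s + dsize (val (Fst a) s)"
| "cost (Snd a) s = cost a s + dsize (val (Snd a) s)"
| "cost (Equal a b) s = cost a s + cost b s + dsize (val (Equal a b) s)"

text \<open>\<open>exec c s n s'\<close>: started in store \<open>s\<close>, command \<open>c\<close> halts in store \<open>s'\<close> after
  time \<open>n\<close>. Every value other than \<open>Atom\<close> counts as true.\<close>

inductive exec :: "com \<Rightarrow> store \<Rightarrow> nat \<Rightarrow> store \<Rightarrow> bool" where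
  Skip: "exec Skip s 1 s"
| Assign: "exec (Assign x e) s (1 + cost e s) (s(x := val e s))"
| Seq: "exec c s m s' \<Longrightarrow> exec d s' n s'' \<Longrightarrow> exec (Seq c d) s (1 + m + n) s''"
| CondTrue: "val e s \<noteq> Atom \<Longrightarrow> exec c s n s' \<Longrightarrow> exec (Cond e c d) s (1 + cost e s + n) s'"
| CondFalse: "val e s = Atom \<Longrightarrow> exec d s n s' \<Longrightarrow> exec (Cond e c d) s (1 + cost e s + n) s'"
| WhileTrue: "val e s \<noteq> Atom \<Longrightarrow> exec c s m s' \<Longrightarrow> exec (While e c) s' n s'' \<Longrightarrow>
    exec (While e c) s (1 + cost e s + m + n) s''"
| WhileFalse: "val e s = Atom \<Longrightarrow> exec (While e c) s (1 + cost e s) s"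

lemma exec_deterministic:
  "exec c s m s' \<Longrightarrow> exec c s n s'' \<Longrightarrow> m = n \<and> s' = s''"
proof (induction arbitrary: n s'' rule: exec.induct)
  case (Skip s)
  from Skip.prems show ?case by cases auto
next
  case (Assign x e s)
  from Assign.prems show ?case by cases auto
next
  case (Seq c s m s' d k t)
  from Seq.prems obtain m' u k' where
    "n = 1 + m' + k'" "exec c s m' u" "exec d u k' s''"
    by cases auto
  then show ?case using Seq.IH(1)[of m' u] Seq.IH(2)[of k' s''] by simp
next
  case (CondTrue e s c k t d)
  from CondTrue.prems CondTrue.hyps obtain k' where
    "n = 1 + cost e s + k'" "exec c s k' s''"
    by cases auto
  then show ?case using CondTrue.IH[of k' s''] by simp
next
  case (CondFalse e s d k t c)
  from CondFalse.prems CondFalse.hyps obtain k' where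
    "n = 1 + cost e s + k'" "exec d s k' s''"
    by cases auto
  then show ?case using CondFalse.IH[of k' s''] by simp
next
  case (WhileTrue e s c m s' k t)
  from WhileTrue.prems WhileTrue.hyps obtain m' u k' where
    "n = 1 + cost e s + m' + k'" "exec c s m' u" "exec (While e c) u k' s''"
    by cases auto
  then show ?case using WhileTrue.IH(1)[of m' u] WhileTrue.IH(2)[of k' s''] by simp
next
  case (WhileFalse e s c)
  from WhileFalse.prems WhileFalse.hyps show ?case by cases auto
qed

text \<open>Input and output are passed in variable 0; all other variables start as \<open>Atom\<close>.\<close>

definition computes :: "com \<Rightarrow> data \<Rightarrow> nat \<Rightarrow> data \<Rightarrow> bool" where
  "computes c d n d' \<longleftrightarrow> (\<exists>s. exec c ((\<lambda>_. Atom)(0 := d)) n s \<and> s 0 = d')"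

lemma dsize_val_le_cost: "dsize (val e s) \<le> cost e s"
  by (cases e) auto

text \<open>A time bound also bounds the size of the output.\<close>

lemma computes_output_size:
  assumes "computes c d n d'"
  shows "dsize d' \<le> max (dsize d) n"
proof -
  have "dsize (s' x) \<le> max (dsize (s x)) k" if "exec c s k s'" for c s k s' x
    using that
  proof (induction arbitrary: x rule: exec.induct)
    case (Assign y e s)
    then show ?case using dsize_val_le_cost[of e s] by auto
  next
    case (Seq c s m s' d n s'')
    then show ?case using Seq.IH(1)[of x] Seq.IH(2)[of x] by linarith
  next
    case (CondTrue e s c n s' d)
    then show ?case using CondTrue.IH[of x] by linarith
  next
    case (CondFalse e s d n s' c)
    then show ?case using CondFalse.IH[of x] by linarith
  next
    case (WhileTrue e s c m s' n s'')
    then show ?case using WhileTrue.IH(1)[of x] WhileTrue.IH(2)[of x] by linarith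
  qed auto
  then have growth: "dsize (s' 0) \<le> max (dsize (s 0)) n" if "exec c s n s'" for s s'
    using that by blast
  from assms obtain s' where "exec c ((\<lambda>_. Atom)(0 := d)) n s'" "s' 0 = d'"
    unfolding computes_def by blast
  with growth[of "(\<lambda>_. Atom)(0 := d)" s'] show ?thesis by simp
qed

text \<open>A map \<open>f\<close> on the domain \<open>D\<close>, where an object may have several encodings (sets can be
  listed in any order): every encoding of \<open>x\<close> has to be turned into some encoding of \<open>f x\<close>.\<close>

definition poly_time_computable ::
    "'a set \<Rightarrow> ('a \<Rightarrow> data \<Rightarrow> bool) \<Rightarrow> ('b \<Rightarrow> data \<Rightarrow> bool) \<Rightarrow> ('a \<Rightarrow> 'b) \<Rightarrow> bool" where
  "poly_time_computable D enc enc' f \<longleftrightarrow>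
     (\<exists>c. \<exists>p :: nat poly. \<forall>x\<in>D. \<forall>d. enc x d \<longrightarrow>
        (\<exists>n d'. computes c d n d' \<and> n \<le> poly p (dsize d) \<and> enc' (f x) d'))"


section \<open>Encodings\<close>

text \<open>Vertices and agents of an instance that is given as input are named by bit strings.\<close>

type_synonym name = "bool list"

definition enc_list :: "('a \<Rightarrow> data) \<Rightarrow> 'a list \<Rightarrow> data" where
  "enc_list f xs = foldr (\<lambda>x. Pair (f x)) xs Atom"

definition enc_name :: "name \<Rightarrow> data" where
  "enc_name = enc_list enc_bool"

text \<open>Unary. Approved numbers are bounded by the number of vertices, and all vertices are listed,
  so that a binary encoding would yield the same notion of polynomial time.\<close>

definition enc_nat :: "nat \<Rightarrow> data" where
  "enc_nat n = (Pair Atom ^^ n) Atom"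

text \<open>Programs as data.\<close>

primrec enc_expr :: "expr \<Rightarrow> data" where
  "enc_expr (Var x) = Pair (enc_nat 0) (enc_nat x)"
| "enc_expr (Const d) = Pair (enc_nat 1) d"
| "enc_expr (MkPair a b) = Pair (enc_nat 2) (Pair (enc_expr a) (enc_expr b))"
| "enc_expr (Fst a) = Pair (enc_nat 3) (enc_expr a)"
| "enc_expr (Snd a) = Pair (enc_nat 4) (enc_expr a)"
| "enc_expr (Equal a b) = Pair (enc_nat 5) (Pair (enc_expr a) (enc_expr b))"

primrec enc_com :: "com \<Rightarrow> data" where
  "enc_com Skip = Pair (enc_nat 0) Atom"
| "enc_com (Assign x e) = Pair (enc_nat 1) (Pair (enc_nat x) (enc_expr e))"
| "enc_com (Seq c d) = Pair (enc_nat 2) (Pair (enc_com c) (enc_com d))"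
| "enc_com (Cond e c d) = Pair (enc_nat 3) (Pair (enc_expr e) (Pair (enc_com c) (enc_com d)))"
| "enc_com (While e c) = Pair (enc_nat 4) (Pair (enc_expr e) (enc_com c))"

lemma enc_nat_eq_iff [simp]: "enc_nat m = enc_nat n \<longleftrightarrow> m = n"
proof (induction m arbitrary: n)
  case 0
  show ?case by (cases n) (auto simp: enc_nat_def)
next
  case (Suc m)
  then show ?case by (cases n) (auto simp: enc_nat_def)
qed

lemma enc_expr_eq_iff [simp]: "enc_expr a = enc_expr b \<longleftrightarrow> a = b"
proof (induction a arbitrary: b)
  case (Var x) show ?case by (cases b) auto
next
  case (Const x) show ?case by (cases b) auto
next
  case (MkPair a1 a2) then show ?case by (cases b) auto
next
  case (Fst a) then show ?case by (cases b) auto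
next
  case (Snd a) then show ?case by (cases b) auto
next
  case (Equal a1 a2) then show ?case by (cases b) auto
qed

lemma enc_com_eq_iff: "enc_com c = enc_com d \<longleftrightarrow> c = d"
proof (induction c arbitrary: d)
  case Skip show ?case by (cases d) auto
next
  case (Assign x e) show ?case by (cases d) auto
next
  case (Seq c1 c2) then show ?case by (cases d) auto
next
  case (Cond e c1 c2) then show ?case by (cases d) auto
next
  case (While e c) then show ?case by (cases d) auto
qed

text \<open>\<open>permutations_of_set A\<close> is the set of all duplicate-free listings of \<open>A\<close>. Every edge is
  listed once, as a pair of its endpoints in either order.\<close>

definition enc_topology :: "name ugraph \<Rightarrow> data \<Rightarrow> bool" where
  "enc_topology G d \<longleftrightarrow> (\<exists>vs es.
     vs \<in> permutations_of_set (verts G) \<and>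
     map (\<lambda>(u, v). {u, v}) es \<in> permutations_of_set (edges G) \<and>
     d = Pair (enc_list enc_name vs)
           (enc_list (\<lambda>(u, v). Pair (enc_name u) (enc_name v)) es))"

definition enc_anonymous :: "(name, name, name) anonymous \<Rightarrow> data \<Rightarrow> bool" where
  "enc_anonymous X d \<longleftrightarrow> (\<exists>g rs hs as.
     enc_topology (topology X) g \<and>
     rs \<in> permutations_of_set (refugees X) \<and>
     hs \<in> permutations_of_set (inhabitants X) \<and>
     (\<forall>h\<in>inhabitants X. as h \<in> permutations_of_set (approved_numbers X h)) \<and>
     d = Pair g (Pair (enc_list enc_name rs)
           (enc_list (\<lambda>h. Pair (enc_name h)
              (Pair (enc_name (iota X h)) (enc_list enc_nat (as h)))) hs)))"

text \<open>\<open>implements_oracle q c U \<A>\<close>: program \<open>c\<close> is an oracle for the family \<open>\<A>\<close> of subsets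
  of \<open>U\<close>, whose running time is bounded by the polynomial \<open>q\<close> in the description size of \<open>c\<close>
  plus the size of the query.\<close>

definition implements_oracle :: "nat poly \<Rightarrow> com \<Rightarrow> name set \<Rightarrow> name set set \<Rightarrow> bool" where
  "implements_oracle q c U \<A> \<longleftrightarrow>
     (\<forall>S\<subseteq>U. \<forall>xs\<in>permutations_of_set S. \<exists>n.
        computes c (enc_list enc_name xs) n (enc_bool (S \<in> \<A>)) \<and>
        n \<le> poly q (dsize (enc_com c) + dsize (enc_list enc_name xs)))"

text \<open>The approval sets of a hedonic instance are not listed; instead, its encoding contains the
  text of one oracle program per agent.\<close>

definition enc_hedonic :: "nat poly \<Rightarrow> (name, name, name) hedonic \<Rightarrow> data \<Rightarrow> bool" where
  "enc_hedonic q X d \<longleftrightarrow> (\<exists>g rs hs cr ch.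
     enc_topology (topology X) g \<and>
     rs \<in> permutations_of_set (refugees X) \<and>
     hs \<in> permutations_of_set (inhabitants X) \<and>
     (\<forall>r\<in>refugees X. implements_oracle q (cr r) (inhabitants X) (refugee_approval X r)) \<and>
     (\<forall>h\<in>inhabitants X. implements_oracle q (ch h) (refugees X) (inhabitant_approval X h)) \<and>
     d = Pair g (Pair (enc_list (\<lambda>r. Pair (enc_name r) (enc_com (cr r))) rs)
           (enc_list (\<lambda>h. Pair (enc_name h)
              (Pair (enc_name (iota X h)) (enc_com (ch h)))) hs)))"

end

theory Submission imports Defs begin

text \<open>
  Every refugee approves of everything, and inhabitant \<open>h\<close> approves of exactly those sets of
  refugees whose cardinality is in \<open>A\<^sub>h\<close>; injectivity of housings makes the number of refugees
  next to \<open>h\<close> equal to the number of occupied neighbouring vertices. The oracle of \<open>h\<close> carries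
  the list \<open>A\<^sub>h\<close> as a constant, computes the length of its query in unary and searches for it in
  that list. Its program text depends on \<open>A\<^sub>h\<close> at a single leaf, so the reduction merely plugs the
  given lists into a fixed context.
\<close>

section \<open>Running times of expressions and list loops\<close>

lemma dsize_pos [simp]: "dsize d > 0"
  by (cases d) auto

lemma one_le_dsize: "1 \<le> dsize d"
  using dsize_pos[of d] by linarith

lemma dsize_data_fst: "dsize (data_fst d) \<le> dsize d"
  by (cases d) auto

lemma dsize_data_snd: "dsize (data_snd d) \<le> dsize d"
  by (cases d) auto

lemma dsize_enc_bool: "dsize (enc_bool b) \<le> 3"
  by (simp add: enc_bool_def)

text \<open>Coefficient of a linear bound on the cost in terms of the largest stored value.
  Subexpressions of \<open>MkPair\<close>, \<open>Fst\<close> and \<open>Snd\<close> count twice,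
  because the size of the result, charged on top, is itself bounded through their costs. For
  \<open>Equal\<close> the result is a truth value of size at most 3.\<close>

primrec cost_factor :: "expr \<Rightarrow> nat" where
  "cost_factor (Var x) = 1"
| "cost_factor (Const d) = dsize d"
| "cost_factor (MkPair a b) = 2 * cost_factor a + 2 * cost_factor b + 1"
| "cost_factor (Fst a) = 2 * cost_factor a"
| "cost_factor (Snd a) = 2 * cost_factor a"
| "cost_factor (Equal a b) = cost_factor a + cost_factor b + 3"

lemma cost_le:
  assumes "\<And>v. dsize (s v) \<le> M"
  shows "cost e s \<le> cost_factor e * M"
proof -
  have M: "1 \<le> M"
    using assms[of 0] one_le_dsize order_trans by blast
  show ?thesis
  proof (induction e)
    case (Var x)
    show ?case using assms[of x] by simp
  next
    case (Const d)
    show ?case using M by simp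
  next
    case (MkPair a b)
    then show ?case
      using dsize_val_le_cost[of a s] dsize_val_le_cost[of b s] M
      by (simp add: algebra_simps)
  next
    case (Fst a)
    then show ?case
      using dsize_val_le_cost[of a s] dsize_data_fst[of "val a s"] by simp
  next
    case (Snd a)
    then show ?case
      using dsize_val_le_cost[of a s] dsize_data_snd[of "val a s"] by simp
  next
    case (Equal a b)
    then show ?case
      using dsize_enc_bool[of "val a s = val b s"] M by (simp add: algebra_simps)
  qed
qed

section \<open>Execution with an upper bound in place of the exact time\<close>

definition exec_within :: "com \<Rightarrow> store \<Rightarrow> nat \<Rightarrow> store \<Rightarrow> bool" where
  "exec_within c s B s' \<longleftrightarrow> (\<exists>n\<le>B. exec c s n s')"

lemma exec_within_mono: "exec_within c s B s' \<Longrightarrow> B \<le> B' \<Longrightarrow> exec_within c s B' s'"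
  unfolding exec_within_def using le_trans by blast

lemma exec_within_Skip: "exec_within Skip s 1 s"
  unfolding exec_within_def using exec.Skip by blast

lemma exec_within_Assign:
  "s' = s(x := val e s) \<Longrightarrow> 1 + cost e s \<le> B \<Longrightarrow> exec_within (Assign x e) s B s'"
  unfolding exec_within_def using exec.Assign by blast

lemma exec_within_Seq:
  assumes "exec_within c s B s'" "exec_within d s' B' s''"
  shows "exec_within (Seq c d) s (1 + B + B') s''"
proof -
  from assms obtain m n where
    "m \<le> B" "exec c s m s'" "n \<le> B'" "exec d s' n s''"
    unfolding exec_within_def by blast
  then have "exec (Seq c d) s (1 + m + n) s''" "1 + m + n \<le> 1 + B + B'"
    using exec.Seq by auto
  then show ?thesis unfolding exec_within_def by blast
qed

text \<open>Both branches share one bound and one final store, so a caller need not know which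
  branch is taken.\<close>

lemma exec_within_Cond:
  assumes "val e s \<noteq> Atom \<Longrightarrow> exec_within c s B s'" "val e s = Atom \<Longrightarrow> exec_within d s B s'"
  shows "exec_within (Cond e c d) s (1 + cost e s + B) s'"
proof (cases "val e s = Atom")
  case True
  with assms obtain n where "n \<le> B" "exec d s n s'"
    unfolding exec_within_def by blast
  then have "exec (Cond e c d) s (1 + cost e s + n) s'" "1 + cost e s + n \<le> 1 + cost e s + B"
    using exec.CondFalse True by auto
  then show ?thesis unfolding exec_within_def by blast
next
  case False
  with assms obtain n where "n \<le> B" "exec c s n s'"
    unfolding exec_within_def by blast
  then have "exec (Cond e c d) s (1 + cost e s + n) s'" "1 + cost e s + n \<le> 1 + cost e s + B"
    using exec.CondTrue False by auto
  then show ?thesis unfolding exec_within_def by blast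
qed

lemma exec_within_WhileTrue:
  assumes "val e s \<noteq> Atom" "exec_within c s B s'" "exec_within (While e c) s' B' s''"
  shows "exec_within (While e c) s (1 + cost e s + B + B') s''"
proof -
  from assms obtain m n where
    "m \<le> B" "exec c s m s'" "n \<le> B'" "exec (While e c) s' n s''"
    unfolding exec_within_def by blast
  then have "exec (While e c) s (1 + cost e s + m + n) s''"
    "1 + cost e s + m + n \<le> 1 + cost e s + B + B'"
    using exec.WhileTrue assms(1) by auto
  then show ?thesis unfolding exec_within_def by blast
qed

lemma exec_within_WhileFalse:
  "val e s = Atom \<Longrightarrow> 1 + cost e s \<le> B \<Longrightarrow> exec_within (While e c) s B s"
  unfolding exec_within_def using exec.WhileFalse by blast

section \<open>Sizes of encoded lists\<close>

lemma enc_list_simps [simp]: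
  "enc_list f [] = Atom"
  "enc_list f (x # xs) = Pair (f x) (enc_list f xs)"
  by (simp_all add: enc_list_def)

text \<open>Replacing every entry by \<open>Atom\<close> turns an encoded list into its unary
  length. This is how the oracles count.\<close>

lemma enc_list_unary: "enc_list (\<lambda>_. Atom) xs = enc_nat (length xs)"
  by (induction xs) (simp_all add: enc_nat_def)

lemma length_less_dsize_enc_list: "length xs < dsize (enc_list f xs)"
  by (induction xs) auto

text \<open>As a sum over the entries, the size is visibly invariant under reversal and monotone
  under appending.\<close>

lemma dsize_enc_list: "dsize (enc_list f xs) = 1 + (\<Sum>x\<leftarrow>xs. 1 + dsize (f x))"
  by (induction xs) auto

lemma dsize_enc_list_rev: "dsize (enc_list f (rev xs)) = dsize (enc_list f xs)"
  by (simp add: dsize_enc_list rev_map [symmetric] sum_list_rev)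

lemma dsize_enc_list_append_le: "dsize (enc_list f xs) \<le> dsize (enc_list f (xs @ ys))"
  by (simp add: dsize_enc_list)

lemma dsize_enc_list_append_le': "dsize (enc_list f ys) \<le> dsize (enc_list f (xs @ ys))"
  by (simp add: dsize_enc_list)

lemma dsize_enc_list_le:
  assumes "1 \<le> C" "\<And>x. x \<in> set xs \<Longrightarrow> dsize (g x) \<le> C * dsize (f x)"
  shows "dsize (enc_list g xs) \<le> C * dsize (enc_list f xs)"
  using assms
proof (induction xs)
  case Nil
  then show ?case by simp
next
  case (Cons x xs)
  have "dsize (g x) \<le> C * dsize (f x)" "dsize (enc_list g xs) \<le> C * dsize (enc_list f xs)"
    using Cons by simp_all
  then show ?case using Cons.prems(1) by (simp add: algebra_simps)
qed

section \<open>Loops over encoded lists\<close>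

abbreviation list_loop :: "nat \<Rightarrow> com \<Rightarrow> com" where
  "list_loop x c \<equiv> While (Var x) (Seq c (Assign x (Snd (Var x))))"

text \<open>\<open>A ys\<close> is the content of the accumulator \<open>a\<close> after the prefix \<open>ys\<close> has been processed.\<close>

lemma exec_within_list_loop:
  assumes "x \<noteq> a"
    and body: "\<And>ys y zs. xs = ys @ y # zs \<Longrightarrow>
      exec_within c (s(x := enc_list f (y # zs), a := A ys)) (k * M)
        (s(x := enc_list f (y # zs), a := A (ys @ [y])))"
    and M: "dsize (enc_list f xs) \<le> M"
  shows "exec_within (list_loop x c) (s(x := enc_list f xs, a := A [])) ((k + 6) * M\<^sup>2)
    (s(x := Atom, a := A xs))"
proof -
  have M1: "1 \<le> M"
    using M one_le_dsize order_trans by blast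
  \<comment> \<open>Each round costs at most \<open>3 + 3 * M + k * M\<close>: the test, the body
    within \<open>k * M\<close>, and the assignment that drops the head. Since \<open>M\<close> is
    at least 1, this is at most \<open>(k + 6) * M\<close>. The extra round in
    \<open>length zs + 1\<close> pays for the final failing test.\<close>
  have "exec_within (list_loop x c) (s(x := enc_list f zs, a := A ys))
      ((length zs + 1) * ((k + 6) * M)) (s(x := Atom, a := A xs))" if "xs = ys @ zs" for ys zs
    using that
  proof (induction zs arbitrary: ys)
    case Nil
    have "exec_within (list_loop x c) (s(x := Atom, a := A xs)) ((k + 6) * M) (s(x := Atom, a := A xs))"
      using \<open>x \<noteq> a\<close> M1 by (intro exec_within_WhileFalse) (auto simp: algebra_simps)
    moreover have "A ys = A xs" "enc_list f [] = Atom"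
      "(length ([] :: 'a list) + 1) * ((k + 6) * M) = (k + 6) * M"
      using Nil by simp_all
    ultimately show ?case by metis
  next
    case (Cons y zs)
    let ?s = "s(x := enc_list f (y # zs), a := A ys)"
    let ?s' = "s(x := enc_list f (y # zs), a := A (ys @ [y]))"
    let ?s'' = "s(x := enc_list f zs, a := A (ys @ [y]))"
    have le: "dsize (enc_list f (y # zs)) \<le> M"
      using M dsize_enc_list_append_le'[of f "y # zs" ys] Cons.prems by simp
    have "exec_within (Assign x (Snd (Var x))) ?s' (1 + 2 * M) ?s''"
      using \<open>x \<noteq> a\<close> le by (intro exec_within_Assign) (auto simp: fun_upd_twist)
    then have step: "exec_within (Seq c (Assign x (Snd (Var x)))) ?s (1 + k * M + (1 + 2 * M)) ?s''"
      using body[OF Cons.prems] exec_within_Seq by blast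
    have rest: "exec_within (list_loop x c) ?s'' ((length zs + 1) * ((k + 6) * M))
        (s(x := Atom, a := A xs))"
      using Cons.IH[of "ys @ [y]"] Cons.prems by (simp del: fun_upd_apply)
    have "val (Var x) ?s \<noteq> Atom"
      using \<open>x \<noteq> a\<close> by simp
    from exec_within_WhileTrue[OF this step rest] show ?case
      by (rule exec_within_mono) (use le \<open>x \<noteq> a\<close> M1 in \<open>auto simp: algebra_simps\<close>)
  qed
  from this[of "[]" xs]
  have "exec_within (list_loop x c) (s(x := enc_list f xs, a := A []))
      ((length xs + 1) * ((k + 6) * M)) (s(x := Atom, a := A xs))" by simp
  then show ?thesis
  proof (rule exec_within_mono)
    \<comment> \<open>The number of rounds is bounded by the size of the list, which makes the total
      quadratic in \<open>M\<close>.\<close>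
    have "length xs + 1 \<le> M"
      using length_less_dsize_enc_list[of xs f] M by simp
    then have "(length xs + 1) * ((k + 6) * M) \<le> M * ((k + 6) * M)"
      by (rule mult_le_mono1)
    then show "(length xs + 1) * ((k + 6) * M) \<le> (k + 6) * M\<^sup>2"
      by (simp add: power2_eq_square mult_ac)
  qed
qed

text \<open>Results are pushed onto the front of the accumulator, so the output list comes out
  reversed. This is harmless, as sets may be listed in any order and a unary length is its own
  reversal.\<close>

abbreviation map_loop :: "nat \<Rightarrow> nat \<Rightarrow> expr \<Rightarrow> com" where
  "map_loop x a e \<equiv> list_loop x (Assign a (MkPair e (Var a)))"

text \<open>The loop rule with accumulator content \<open>enc_list g (rev ys)\<close>. The
  hypothesis on \<open>e\<close> ranges over all stores and tails: its value is determined by the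
  head of the list in \<open>x\<close>. Reversal preserves size, so the bound on the whole output
  also bounds each partial accumulator.\<close>

lemma exec_within_map_loop:
  assumes "x \<noteq> a"
    and val: "\<And>y t s. y \<in> set xs \<Longrightarrow> s x = Pair (f y) t \<Longrightarrow> val e s = g y"
    and s: "s x = enc_list f xs" "s a = Atom"
    and M: "\<And>v. dsize (s v) \<le> M" "dsize (enc_list g xs) \<le> M"
  shows "exec_within (map_loop x a e) s ((cost_factor (MkPair e (Var a)) + 7) * M\<^sup>2)
    (s(x := Atom, a := enc_list g (rev xs)))"
proof -
  let ?k = "cost_factor (MkPair e (Var a)) + 1"
  have M1: "1 \<le> M"
    using M(2) one_le_dsize order_trans by blast
  have "exec_within (map_loop x a e) (s(x := enc_list f xs, a := enc_list g (rev [])))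
      ((?k + 6) * M\<^sup>2) (s(x := Atom, a := enc_list g (rev xs)))"
  proof (rule exec_within_list_loop[OF \<open>x \<noteq> a\<close>, where A = "\<lambda>ys. enc_list g (rev ys)"])
    show "dsize (enc_list f xs) \<le> M"
      using M(1)[of x] s by simp
  next
    fix ys y zs assume xs: "xs = ys @ y # zs"
    let ?s = "s(x := enc_list f (y # zs), a := enc_list g (rev ys))"
    have "dsize (enc_list f (y # zs)) \<le> M"
      using M(1)[of x] s(1) dsize_enc_list_append_le'[of f "y # zs" ys] xs by simp
    moreover have "dsize (enc_list g (rev ys)) \<le> M"
      using M(2) dsize_enc_list_append_le[of g ys "y # zs"] xs by (simp add: dsize_enc_list_rev)
    ultimately have "dsize (?s v) \<le> M" for v
      using M(1) by simp
    then have "cost (MkPair e (Var a)) ?s \<le> cost_factor (MkPair e (Var a)) * M"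
      by (rule cost_le)
    moreover have "val e ?s = g y"
      using xs \<open>x \<noteq> a\<close> by (intro val) auto
    ultimately show "exec_within (Assign a (MkPair e (Var a))) ?s (?k * M)
        (s(x := enc_list f (y # zs), a := enc_list g (rev (ys @ [y]))))"
      using M1 by (intro exec_within_Assign) (auto simp: algebra_simps)
  qed
  \<comment> \<open>The loop rule speaks of updated stores; at the start these updates change
    nothing.\<close>
  moreover have "s(x := enc_list f xs, a := enc_list g (rev [])) = s"
    using s by auto
  ultimately show ?thesis
    by (simp add: algebra_simps)
qed

section \<open>The oracles\<close>

definition always_true :: com where
  "always_true = Assign 0 (Const (enc_bool True))"

text \<open>Body of the search loop: variable 1 holds the rest of the list, variable 2 the number
  sought, and variable 0 a flag that is set but never reset.\<close>

definition member_test :: com where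
  "member_test = Cond (Equal (Fst (Var 1)) (Var 2)) (Assign 0 (Const (enc_bool True))) Skip"

text \<open>Counting consumes the query in variable 0 and leaves \<open>Atom\<close> there, which is
  the flag value "not found" that the search starts from. This fixed program is kept apart from the
  list of approved numbers, so that its text can be a constant of the reduction.\<close>

definition length_search :: com where
  "length_search = Seq (map_loop 0 2 (Const Atom)) (list_loop 1 member_test)"

definition length_oracle :: "data \<Rightarrow> com" where
  "length_oracle L = Seq (Assign 1 (Const L)) length_search"

lemma exec_within_member_loop:
  assumes s: "s 0 = Atom" "s 1 = enc_list enc_nat as" "s 2 = enc_nat m"
    and M: "\<And>v. dsize (s v) \<le> M" "3 \<le> M"
  shows "exec_within (list_loop 1 member_test) s (19 * M\<^sup>2)
    (s(1 := Atom, 0 := enc_bool (m \<in> set as)))"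
proof -
  have "exec_within (list_loop 1 member_test) (s(1 := enc_list enc_nat as, 0 := enc_bool (m \<in> set [])))
      ((13 + 6) * M\<^sup>2) (s(1 := Atom, 0 := enc_bool (m \<in> set as)))"
  proof (rule exec_within_list_loop[where A = "\<lambda>ys. enc_bool (m \<in> set ys)"])
    show "dsize (enc_list enc_nat as) \<le> M"
      using M(1)[of 1] s by simp
  next
    fix ys y zs assume as: "as = ys @ y # zs"
    let ?s = "s(1 := enc_list enc_nat (y # zs), 0 := enc_bool (m \<in> set ys))"
    let ?s' = "s(1 := enc_list enc_nat (y # zs), 0 := enc_bool (m \<in> set (ys @ [y])))"
    let ?e = "Equal (Fst (Var 1)) (Var 2)"
    have "dsize (enc_list enc_nat (y # zs)) \<le> M"
      using M(1)[of 1] s(2) dsize_enc_list_append_le'[of enc_nat "y # zs" ys] as by simp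
    then have "dsize (?s v) \<le> M" for v
      using M dsize_enc_bool[of "m \<in> set ys"] by simp
    then have "cost ?e ?s \<le> cost_factor ?e * M"
      by (rule cost_le)
    then have cost: "cost ?e ?s \<le> 6 * M" by simp
    have val: "val ?e ?s = enc_bool (y = m)"
      using s by simp
    \<comment> \<open>Setting the flag takes time 4: one for the assignment and three for the size
      of the constant. The time of \<open>Skip\<close> is padded to the same value. In total
      \<open>6 * M + 5\<close>, hence at most \<open>13 * M\<close>.\<close>
    have "exec_within (Cond ?e (Assign 0 (Const (enc_bool True))) Skip) ?s
        (1 + cost ?e ?s + 4) ?s'"
    proof (rule exec_within_Cond)
      assume "val ?e ?s \<noteq> Atom"
      then have "y = m" unfolding val by (auto simp: enc_bool_def split: if_splits)
      then show "exec_within (Assign 0 (Const (enc_bool True))) ?s 4 ?s'"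
        by (intro exec_within_Assign) (auto simp: enc_bool_def)
    next
      assume "val ?e ?s = Atom"
      then have "y \<noteq> m" unfolding val by (auto simp: enc_bool_def split: if_splits)
      then have "?s' = ?s" by auto
      then show "exec_within Skip ?s 4 ?s'"
        using exec_within_mono[OF exec_within_Skip[of ?s], of 4] by simp
    qed
    then show "exec_within member_test ?s (13 * M) ?s'"
      unfolding member_test_def by (rule exec_within_mono) (use cost M(2) in linarith)
  qed simp
  moreover have "s(1 := enc_list enc_nat as, 0 := enc_bool (m \<in> set [])) = s"
    using s by (auto simp: enc_bool_def)
  ultimately show ?thesis by simp
qed

lemma computes_length_oracle:
  assumes "dsize (enc_list f xs) + dsize (enc_list enc_nat as) \<le> M" "3 \<le> M"
  shows "\<exists>n\<le>35 * M\<^sup>2. computes (length_oracle (enc_list enc_nat as)) (enc_list f xs) n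
    (enc_bool (length xs \<in> set as))"
proof -
  let ?L = "enc_list enc_nat as"
  let ?s0 = "(\<lambda>_. Atom)(0 := enc_list f xs) :: store"
  let ?s1 = "?s0(1 := ?L)"
  let ?s2 = "?s1(0 := Atom, 2 := enc_list (\<lambda>_. Atom) (rev xs))"
  let ?s3 = "?s2(1 := Atom, 0 := enc_bool (length xs \<in> set as))"
  have sizes: "dsize ?L \<le> M" "dsize (enc_list f xs) \<le> M" "1 \<le> M"
    using assms by linarith+
  have count: "dsize (enc_list (\<lambda>_. Atom) xs) \<le> M"
    using dsize_enc_list_le[of 1 xs "\<lambda>_. Atom" f] sizes one_le_dsize by simp
  have "exec_within (Assign 1 (Const ?L)) ?s0 (1 + M) ?s1"
    using sizes by (intro exec_within_Assign) auto
  moreover have "exec_within (map_loop 0 2 (Const Atom)) ?s1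
      ((cost_factor (MkPair (Const Atom) (Var 2)) + 7) * M\<^sup>2) ?s2"
    by (rule exec_within_map_loop[where f = f]) (use sizes count in auto)
  moreover have "exec_within (list_loop 1 member_test) ?s2 (19 * M\<^sup>2) ?s3"
    by (rule exec_within_member_loop)
      (use sizes count assms(2) in \<open>auto simp: dsize_enc_list_rev enc_list_unary\<close>)
  ultimately have "exec_within (length_oracle ?L) ?s0
      (1 + (1 + M) + (1 + (cost_factor (MkPair (Const Atom) (Var 2)) + 7) * M\<^sup>2 + 19 * M\<^sup>2)) ?s3"
    unfolding length_oracle_def length_search_def by (intro exec_within_Seq)
  then have "exec_within (length_oracle ?L) ?s0 (35 * M\<^sup>2) ?s3"
  proof (rule exec_within_mono)
    \<comment> \<open>The counting loop contributes 12 and the search 19 times the square of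
      \<open>M\<close>. The remaining \<open>3 + M\<close> is absorbed with
      \<open>3 \<le> M\<close>.\<close>
    have "3 * M \<le> M\<^sup>2" using assms(2) by (simp add: power2_eq_square)
    then show "1 + (1 + M) + (1 + (cost_factor (MkPair (Const Atom) (Var 2)) + 7) * M\<^sup>2 + 19 * M\<^sup>2)
        \<le> 35 * M\<^sup>2"
      using assms(2) by simp
  qed
  then show ?thesis
    unfolding computes_def exec_within_def by fastforce
qed

text \<open>One polynomial for all agents of all instances.\<close>

definition oracle_time :: "nat poly" where
  "oracle_time = monom 35 2"

lemma poly_oracle_time: "poly oracle_time n = 35 * n\<^sup>2"
  by (simp add: oracle_time_def poly_monom)

lemma implements_oracle_always_true: "implements_oracle oracle_time always_true U (Pow U)"
  unfolding implements_oracle_def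
proof (intro allI impI ballI)
  fix S :: "name set" and xs
  assume "S \<subseteq> U"
  let ?d = "enc_list enc_name xs"
  let ?N = "dsize (enc_com always_true) + dsize ?d"
  have "exec always_true ((\<lambda>_. Atom)(0 := ?d)) (1 + cost (Const (enc_bool True)) ((\<lambda>_. Atom)(0 := ?d)))
      (((\<lambda>_. Atom)(0 := ?d))(0 := val (Const (enc_bool True)) ((\<lambda>_. Atom)(0 := ?d))))"
    unfolding always_true_def by (rule exec.Assign)
  then have "computes always_true ?d 4 (enc_bool (S \<in> Pow U))"
    unfolding computes_def using \<open>S \<subseteq> U\<close> by (auto simp: enc_bool_def numeral_eq_Suc)
  moreover have "1 \<le> ?N\<^sup>2"
    using one_le_dsize[of ?d] by (simp add: one_le_power)
  then have "4 \<le> poly oracle_time ?N"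
    by (simp add: poly_oracle_time)
  ultimately show "\<exists>n. computes always_true ?d n (enc_bool (S \<in> Pow U)) \<and> n \<le> poly oracle_time ?N"
    by blast
qed

text \<open>The list of approved numbers is part of the program text, so its size is covered by the
  description size of the oracle. Hence the bound is uniform although the list varies.\<close>

lemma implements_oracle_length_oracle:
  "implements_oracle oracle_time (length_oracle (enc_list enc_nat as)) U {S. S \<subseteq> U \<and> card S \<in> set as}"
  unfolding implements_oracle_def
proof (intro allI impI ballI)
  fix S :: "name set" and xs
  assume S: "S \<subseteq> U" "xs \<in> permutations_of_set S"
  let ?d = "enc_list enc_name xs"
  let ?c = "length_oracle (enc_list enc_nat as)"
  let ?N = "dsize (enc_com ?c) + dsize ?d"
  have "length xs = card S"
    using S(2) by (metis distinct_card permutations_of_setD(1,2))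
  moreover have "\<exists>n\<le>35 * ?N\<^sup>2. computes ?c ?d n (enc_bool (length xs \<in> set as))"
    by (rule computes_length_oracle) (simp_all add: length_oracle_def)
  ultimately show "\<exists>n. computes ?c ?d n (enc_bool (S \<in> {S. S \<subseteq> U \<and> card S \<in> set as})) \<and>
      n \<le> poly oracle_time ?N"
    using S(1) by (auto simp: poly_oracle_time)
qed

section \<open>The reduction\<close>

definition to_hedonic :: "('v, 'r, 'i) anonymous \<Rightarrow> ('v, 'r, 'i) hedonic" where
  "to_hedonic X = \<lparr>topology = topology X, refugees = refugees X, inhabitants = inhabitants X,
     iota = iota X, refugee_approval = \<lambda>_. Pow (inhabitants X),
     inhabitant_approval = \<lambda>h. {S. S \<subseteq> refugees X \<and> card S \<in> approved_numbers X h}\<rparr>"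

lemma to_hedonic_simps [simp]:
  "topology (to_hedonic X) = topology X"
  "refugees (to_hedonic X) = refugees X"
  "inhabitants (to_hedonic X) = inhabitants X"
  "iota (to_hedonic X) = iota X"
  "refugee_approval (to_hedonic X) r = Pow (inhabitants X)"
  "inhabitant_approval (to_hedonic X) h = {S. S \<subseteq> refugees X \<and> card S \<in> approved_numbers X h}"
  by (simp_all add: to_hedonic_def)

lemma hedonic_instance_to_hedonic: "anonymous_instance X \<Longrightarrow> hedonic_instance (to_hedonic X)"
  by (auto simp: anonymous_instance_def hedonic_instance_def valid_setting_def)

lemma card_adjacent_refugees:
  assumes "housing X \<pi>"
  shows "card {r \<in> refugees X. \<pi> r \<in> N} = card (N \<inter> \<pi> ` refugees X)"
proof -
  have "N \<inter> \<pi> ` refugees X = \<pi> ` {r \<in> refugees X. \<pi> r \<in> N}"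
    by auto
  moreover have "inj_on \<pi> {r \<in> refugees X. \<pi> r \<in> N}"
    using assms unfolding housing_def by (auto intro: inj_on_subset)
  ultimately show ?thesis by (simp add: card_image)
qed

lemma hedonic_yes_to_hedonic: "hedonic_yes (to_hedonic X) \<longleftrightarrow> anonymous_yes X"
proof -
  have "housing (to_hedonic X) \<pi> \<longleftrightarrow> housing X \<pi>" for \<pi>
    by (simp add: housing_def)
  \<comment> \<open>The refugees' half of \<open>respecting\<close> is trivial, since any set of
    adjacent inhabitants lies in \<open>Pow (inhabitants X)\<close>.\<close>
  moreover have "respecting (to_hedonic X) \<pi> \<longleftrightarrow> (\<forall>h\<in>inhabitants X.
      card (neighbours (topology X) (iota X h) \<inter> \<pi> ` refugees X) \<in> approved_numbers X h)"
    if "housing X \<pi>" for \<pi>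
    using card_adjacent_refugees[OF that] by (auto simp: respecting_def)
  ultimately show ?thesis
    unfolding hedonic_yes_def anonymous_yes_def by blast
qed

section \<open>The program that writes the hedonic instance\<close>

definition refugee_expr :: expr where
  "refugee_expr = MkPair (Fst (Var 1)) (Const (enc_com always_true))"

text \<open>The last component evaluates to \<open>enc_com (length_oracle L)\<close>, where \<open>L\<close> is the list of
  approved numbers of the first inhabitant listed in variable 2.\<close>

definition inhabitant_expr :: expr where
  "inhabitant_expr = MkPair (Fst (Fst (Var 2))) (MkPair (Fst (Snd (Fst (Var 2))))
     (MkPair (Const (enc_nat 2)) (MkPair
        (MkPair (Const (enc_nat 1)) (MkPair (Const (enc_nat 1))
           (MkPair (Const (enc_nat 1)) (Snd (Snd (Fst (Var 2)))))))
        (Const (enc_com length_search)))))"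

text \<open>Variables 1 and 2 receive the input lists of refugees and inhabitants, and 3 and 4
  collect the output lists. Variable 0 keeps the input until the end, so that the encoded topology
  is copied verbatim.\<close>

definition reduction :: com where
  "reduction = Seq (Assign 1 (Fst (Snd (Var 0)))) (Seq (Assign 2 (Snd (Snd (Var 0))))
     (Seq (map_loop 1 3 refugee_expr) (Seq (map_loop 2 4 inhabitant_expr)
        (Assign 0 (MkPair (Fst (Var 0)) (MkPair (Var 3) (Var 4)))))))"

text \<open>\<open>C\<close> bounds the factor by which a list entry grows when a program text is
  attached to it. \<open>K\<close> collects the coefficients of the two loops and of the
  assignments. Neither depends on the input.\<close>

lemma computes_reduction:
  fixes g :: data and rs hs :: "name list" and io :: "name \<Rightarrow> name" and as :: "name \<Rightarrow> nat list"
  defines "C \<equiv> dsize (enc_com always_true) + dsize (enc_com length_search) + 50"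
  defines "K \<equiv> cost_factor (MkPair refugee_expr (Var 3))
    + cost_factor (MkPair inhabitant_expr (Var 4)) + 50"
  defines "d \<equiv> Pair g (Pair (enc_list enc_name rs)
           (enc_list (\<lambda>h. Pair (enc_name h)
              (Pair (enc_name (io h)) (enc_list enc_nat (as h)))) hs))"
  shows "\<exists>n\<le>K * (C * dsize d)\<^sup>2. computes reduction d n
    (Pair g (Pair (enc_list (\<lambda>r. Pair (enc_name r) (enc_com always_true)) (rev rs))
           (enc_list (\<lambda>h. Pair (enc_name h) (Pair (enc_name (io h))
              (enc_com (length_oracle (enc_list enc_nat (as h)))))) (rev hs))))"
proof -
  define fh where "fh = (\<lambda>h. Pair (enc_name h) (Pair (enc_name (io h)) (enc_list enc_nat (as h))))"
  define gr where "gr = (\<lambda>r. Pair (enc_name r) (enc_com always_true))"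
  define gh where "gh = (\<lambda>h. Pair (enc_name h) (Pair (enc_name (io h))
    (enc_com (length_oracle (enc_list enc_nat (as h))))))"
  have d: "d = Pair g (Pair (enc_list enc_name rs) (enc_list fh hs))"
    by (simp add: d_def fh_def)
  \<comment> \<open>A common bound on all stored values up to the final assignment, output lists
    included.\<close>
  define M where "M = C * dsize d"
  have C: "50 \<le> C" by (simp add: C_def)
  have dM: "dsize d \<le> M" using C by (simp add: M_def)
  then have M1: "1 \<le> M"
    using one_le_dsize order_trans by blast
  \<comment> \<open>The attached text adds less than \<open>C\<close> nodes. As every tree has a
    node, this additive growth is at most a factor of \<open>C\<close>.\<close>
  have gr_le: "dsize (gr r) \<le> C * dsize (enc_name r)" for r
  proof -
    have "dsize (gr r) \<le> dsize (enc_name r) + (C - 1)"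
      by (simp add: gr_def C_def)
    also have "(C - 1) \<le> (C - 1) * dsize (enc_name r)" by (simp add: Suc_le_eq)
    also have "dsize (enc_name r) + (C - 1) * dsize (enc_name r) = C * dsize (enc_name r)"
      using C by (cases C) auto
    finally show ?thesis by simp
  qed
  have gh_le: "dsize (gh h) \<le> C * dsize (fh h)" for h
  proof -
    have "dsize (gh h) \<le> dsize (fh h) + (C - 1)"
      by (simp add: gh_def fh_def C_def length_oracle_def enc_nat_def numeral_2_eq_2)
    also have "(C - 1) \<le> (C - 1) * dsize (fh h)" by (simp add: Suc_le_eq)
    also have "dsize (fh h) + (C - 1) * dsize (fh h) = C * dsize (fh h)"
      using C by (cases C) auto
    finally show ?thesis by simp
  qed
  have "dsize (enc_list gr rs) \<le> C * dsize (enc_list enc_name rs)"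
    using C gr_le by (intro dsize_enc_list_le) auto
  also have "\<dots> \<le> M" unfolding M_def d by (intro mult_le_mono) auto
  finally have grM: "dsize (enc_list gr rs) \<le> M" .
  have "dsize (enc_list gh hs) \<le> C * dsize (enc_list fh hs)"
    using C gh_le by (intro dsize_enc_list_le) auto
  also have "\<dots> \<le> M" unfolding M_def d by (intro mult_le_mono) auto
  finally have ghM: "dsize (enc_list gh hs) \<le> M" .
  let ?s0 = "(\<lambda>_. Atom)(0 := d) :: store"
  let ?s1 = "?s0(1 := enc_list enc_name rs)"
  let ?s2 = "?s1(2 := enc_list fh hs)"
  let ?s3 = "?s2(1 := Atom, 3 := enc_list gr (rev rs))"
  let ?s4 = "?s3(2 := Atom, 4 := enc_list gh (rev hs))"
  let ?out = "Pair g (Pair (enc_list gr (rev rs)) (enc_list gh (rev hs)))"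
  have sizes: "dsize (enc_list enc_name rs) \<le> M" "dsize (enc_list fh hs) \<le> M" "dsize g \<le> M"
    using dM unfolding d by simp_all
  have 1: "exec_within (Assign 1 (Fst (Snd (Var 0)))) ?s0 (5 * M) ?s1"
  proof (rule exec_within_Assign)
    have "dsize (?s0 v) \<le> M" for v
      using dM M1 by simp
    from cost_le[of ?s0 M "Fst (Snd (Var 0))", OF this] M1
    show "1 + cost (Fst (Snd (Var 0))) ?s0 \<le> 5 * M" by simp
  qed (simp add: d)
  have 2: "exec_within (Assign 2 (Snd (Snd (Var 0)))) ?s1 (5 * M) ?s2"
  proof (rule exec_within_Assign)
    have "dsize (?s1 v) \<le> M" for v
      using dM M1 sizes by simp
    from cost_le[of ?s1 M "Snd (Snd (Var 0))", OF this] M1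
    show "1 + cost (Snd (Snd (Var 0))) ?s1 \<le> 5 * M" by simp
  qed (simp add: d)
  have 3: "exec_within (map_loop 1 3 refugee_expr) ?s2
      ((cost_factor (MkPair refugee_expr (Var 3)) + 7) * M\<^sup>2) ?s3"
    by (rule exec_within_map_loop[where f = enc_name])
      (use dM M1 sizes grM in \<open>auto simp: refugee_expr_def gr_def\<close>)
  \<comment> \<open>Unfolding the oracle exposes the layout that \<open>inhabitant_expr\<close>
    builds: tag 2 for \<open>Seq\<close>, then tag 1 for \<open>Assign\<close>, the variable number
    1, tag 1 for \<open>Const\<close>, and the list itself, which \<open>Const\<close> embeds
    unchanged.\<close>
  have 4: "exec_within (map_loop 2 4 inhabitant_expr) ?s3
      ((cost_factor (MkPair inhabitant_expr (Var 4)) + 7) * M\<^sup>2) ?s4"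
    by (rule exec_within_map_loop[where f = fh])
      (use dM M1 sizes grM ghM in
        \<open>auto simp: inhabitant_expr_def gh_def fh_def length_oracle_def dsize_enc_list_rev\<close>)
  have 5: "exec_within (Assign 0 (MkPair (Fst (Var 0)) (MkPair (Var 3) (Var 4)))) ?s4 (20 * M)
      (?s4(0 := ?out))"
  proof (rule exec_within_Assign)
    have "dsize (?s4 v) \<le> M" for v
      using dM M1 grM ghM by (simp add: dsize_enc_list_rev)
    from cost_le[of ?s4 M "MkPair (Fst (Var 0)) (MkPair (Var 3) (Var 4))", OF this] M1
    show "1 + cost (MkPair (Fst (Var 0)) (MkPair (Var 3) (Var 4))) ?s4 \<le> 20 * M" by simp
  qed (simp add: d)
  note run = exec_within_Seq[OF 1 exec_within_Seq[OF 2 exec_within_Seq[OF 3 exec_within_Seq[OF 4 5]]]]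
  \<comment> \<open>Beyond the two loop coefficients the run takes \<open>4 + 30 * M\<close> plus 14
    times the square of \<open>M\<close>, which the 50 in \<open>K\<close> covers.\<close>
  have "M \<le> M\<^sup>2" "1 \<le> M\<^sup>2"
    using M1 by (simp_all add: power2_eq_square)
  then have "exec_within reduction ?s0 (K * M\<^sup>2) (?s4(0 := ?out))"
    unfolding reduction_def
    by (intro exec_within_mono[OF run]) (simp add: K_def algebra_simps)
  then show ?thesis
    unfolding computes_def exec_within_def M_def gr_def gh_def by fastforce
qed

text \<open>Reversed listings are still listings of the same sets, and any listing
  \<open>as h\<close> has \<open>approved_numbers X h\<close> as its set of entries, so the oracle
  built from it decides the right family.\<close>

lemma enc_hedonic_to_hedonic:
  assumes "enc_topology (topology X) g"
    and rs: "rs \<in> permutations_of_set (refugees X)"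
    and hs: "hs \<in> permutations_of_set (inhabitants X)"
    and as: "\<forall>h\<in>inhabitants X. as h \<in> permutations_of_set (approved_numbers X h)"
  shows "enc_hedonic oracle_time (to_hedonic X)
    (Pair g (Pair (enc_list (\<lambda>r. Pair (enc_name r) (enc_com always_true)) (rev rs))
           (enc_list (\<lambda>h. Pair (enc_name h) (Pair (enc_name (iota X h))
              (enc_com (length_oracle (enc_list enc_nat (as h)))))) (rev hs))))"
proof -
  have "rev rs \<in> permutations_of_set (refugees X)" "rev hs \<in> permutations_of_set (inhabitants X)"
    using rs hs by (simp_all add: permutations_of_set_def)
  moreover have "implements_oracle oracle_time (length_oracle (enc_list enc_nat (as h)))
      (refugees X) (inhabitant_approval (to_hedonic X) h)" if "h \<in> inhabitants X" for h
    using implements_oracle_length_oracle[of "as h" "refugees X"] as that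
    by (simp add: permutations_of_set_def)
  ultimately show ?thesis
    unfolding enc_hedonic_def using assms(1) implements_oracle_always_true
    by (intro exI[of _ g] exI[of _ "rev rs"] exI[of _ "rev hs"] exI[of _ "\<lambda>_. always_true"]
        exI[of _ "\<lambda>h. length_oracle (enc_list enc_nat (as h))"]) simp
qed

lemma poly_time_to_hedonic:
  "poly_time_computable D enc_anonymous (enc_hedonic oracle_time) to_hedonic"
proof -
  define C where "C = dsize (enc_com always_true) + dsize (enc_com length_search) + 50"
  define K where "K = cost_factor (MkPair refugee_expr (Var 3))
    + cost_factor (MkPair inhabitant_expr (Var 4)) + 50"
  have "\<exists>n d'. computes reduction d n d' \<and> n \<le> poly (monom (K * C\<^sup>2) 2) (dsize d) \<and>
      enc_hedonic oracle_time (to_hedonic X) d'" if "enc_anonymous X d" for X d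
  proof -
    from that obtain g rs hs as where enc: "enc_topology (topology X) g"
      "rs \<in> permutations_of_set (refugees X)" "hs \<in> permutations_of_set (inhabitants X)"
      "\<forall>h\<in>inhabitants X. as h \<in> permutations_of_set (approved_numbers X h)"
      and d: "d = Pair g (Pair (enc_list enc_name rs)
           (enc_list (\<lambda>h. Pair (enc_name h)
              (Pair (enc_name (iota X h)) (enc_list enc_nat (as h)))) hs))"
      unfolding enc_anonymous_def by blast
    \<comment> \<open>The constants are independent of \<open>X\<close> and of the chosen encoding,
      so the single monomial with coefficient \<open>K * C\<^sup>2\<close> bounds all runs.\<close>
    from computes_reduction[of g rs "iota X" as hs, folded d C_def K_def] enc_hedonic_to_hedonic[OF enc]
    show ?thesis
      by (auto simp: poly_monom power_mult_distrib mult.assoc)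
  qed
  then show ?thesis
    unfolding poly_time_computable_def by blast
qed

theorem theorem4p3:
  "\<exists>(f :: (name, name, name) anonymous \<Rightarrow> (name, name, name) hedonic) (q :: nat poly).
     poly_time_computable {X. anonymous_instance X} enc_anonymous (enc_hedonic q) f \<and>
     (\<forall>X. anonymous_instance X \<longrightarrow>
        hedonic_instance (f X) \<and>
        topology (f X) = topology X \<and>
        refugees (f X) = refugees X \<and>
        inhabitants (f X) = inhabitants X \<and>
        iota (f X) = iota X \<and>
        (anonymous_yes X \<longleftrightarrow> hedonic_yes (f X)))"
  by (intro exI[of _ to_hedonic] exI[of _ oracle_time] conjI allI impI poly_time_to_hedonic)
    (simp_all add: hedonic_instance_to_hedonic hedonic_yes_to_hedonic)

end
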